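(* Let $n\ge3$, let $g_1,\ldots,g_n>0$, and let $D_t=\operatorname{diag}(t^{g_1},\ldots,t^{g_n})$ for $t>0$. If two of the weights coincide, i.e. $g_a=g_b$ for some $a\ne b$, then there exists a connected real-analytic embedded nonflat minimal hypersurface $\Sigma\subset\mathbb R^n$ such that $D_t\Sigma$ is minimal for every $t>0$.
   Context: Hypersurfaces are not assumed complete or closed (patches are allowed). A hypersurface is minimal if its Euclidean mean-curvature vector vanishes identically, and nonflat if its second fundamental form is not identically zero. *)

theory Defs
  imports "HOL-Analysis.Analysis"
begin

text \<open>Near every point of \<open>U\<close>, \<open>f\<close> is the sum of an absolutely convergent power series in
  \<open>n\<close> variables; the multi-indices are the functions \<open>\<alpha> :: 'n \<Rightarrow> nat\<close>.\<close>

definition real_analytic_on :: "(real^'n \<Rightarrow> real) \<Rightarrow> (real^'n) set \<Rightarrow> bool" where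
  "real_analytic_on f U \<longleftrightarrow>
     (\<forall>p\<in>U. \<exists>r>0. \<exists>c :: ('n \<Rightarrow> nat) \<Rightarrow> real. \<forall>x\<in>ball p r.
        ((\<lambda>\<alpha>. c \<alpha> * (\<Prod>i\<in>UNIV. (x $ i - p $ i) ^ \<alpha> i)) has_sum f x) UNIV)"

definition C2_on :: "(real^'n \<Rightarrow> real) \<Rightarrow> (real^'n) set \<Rightarrow> bool" where
  "C2_on f U \<longleftrightarrow>
     (\<exists>(G :: real^'n \<Rightarrow> real^'n) (H :: real^'n \<Rightarrow> real^'n^'n).
        (\<forall>x\<in>U. (f has_derivative (\<lambda>h. G x \<bullet> h)) (at x)) \<and>
        (\<forall>x\<in>U. (G has_derivative (\<lambda>h. H x *v h)) (at x)) \<and>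
        continuous_on U H)"

text \<open>An embedded hypersurface of regularity \<open>P\<close> is a subset of \<open>\<real>\<^sup>n\<close> which near each of its
  points is the zero set of a function of class \<open>P\<close> without critical points. It need not be
  closed: the open set \<open>U\<close> is only required around points of \<open>S\<close>.\<close>

definition embedded_hypersurface ::
    "((real^'n \<Rightarrow> real) \<Rightarrow> (real^'n) set \<Rightarrow> bool) \<Rightarrow> (real^'n) set \<Rightarrow> bool" where
  "embedded_hypersurface P S \<longleftrightarrow>
     (\<forall>p\<in>S. \<exists>U f. open U \<and> p \<in> U \<and> P f U \<and> S \<inter> U = {x\<in>U. f x = 0} \<and>
        (\<forall>x\<in>U. \<exists>f'. (f has_derivative f') (at x) \<and> f' \<noteq> (\<lambda>h. 0)))"

definition tangent_space :: "(real^'n) set \<Rightarrow> real^'n \<Rightarrow> (real^'n) set" where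
  "tangent_space S p =
     {v. \<exists>\<epsilon>>0. \<exists>\<gamma> :: real \<Rightarrow> real^'n. \<gamma> ` {-\<epsilon><..<\<epsilon>} \<subseteq> S \<and> \<gamma> 0 = p \<and>
           (\<gamma> has_vector_derivative v) (at 0)}"

definition tangent_extension ::
    "(real^'n) set \<Rightarrow> real^'n \<Rightarrow> real^'n \<Rightarrow> (real^'n \<Rightarrow> real^'n) \<Rightarrow> bool" where
  "tangent_extension S p v V \<longleftrightarrow> V p = v \<and>
     (\<exists>U. open U \<and> p \<in> U \<and> V differentiable_on U \<and> (\<forall>q\<in>S \<inter> U. V q \<in> tangent_space S q))"

text \<open>The vector-valued second fundamental form \<open>II(u, v) = (D\<^sub>u V)\<^sup>\<bottom>\<close>, with \<open>D\<close> the flat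
  connection of \<open>\<real>\<^sup>n\<close>, \<open>V\<close> any tangent extension of \<open>v\<close>, and \<open>\<bottom>\<close> the component normal to
  \<open>S\<close> at \<open>p\<close>. On an embedded \<open>C\<^sup>2\<close> hypersurface this is independent of \<open>V\<close>;
  it is meaningful only for \<open>p \<in> S\<close> and tangent \<open>u\<close>, \<open>v\<close>.\<close>

definition second_fundamental_form ::
    "(real^'n) set \<Rightarrow> real^'n \<Rightarrow> real^'n \<Rightarrow> real^'n \<Rightarrow> real^'n" where
  "second_fundamental_form S p u v =
     (THE w. \<exists>V. tangent_extension S p v V \<and>
        frechet_derivative V (at p) u - w \<in> tangent_space S p \<and>
        (\<forall>z\<in>tangent_space S p. w \<bullet> z = 0))"

definition orthonormal_basis_of :: "(real^'n) set \<Rightarrow> (real^'n) set \<Rightarrow> bool" where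
  "orthonormal_basis_of T B \<longleftrightarrow>
     pairwise orthogonal B \<and> (\<forall>e\<in>B. norm e = 1) \<and> span B = T"

text \<open>The trace of the second fundamental form, without the factor \<open>1/(n - 1)\<close>.\<close>

definition mean_curvature_vector :: "(real^'n) set \<Rightarrow> real^'n \<Rightarrow> real^'n" where
  "mean_curvature_vector S p =
     (THE h. \<exists>B. orthonormal_basis_of (tangent_space S p) B \<and>
        h = (\<Sum>e\<in>B. second_fundamental_form S p e e))"

definition minimal_hypersurface :: "(real^'n) set \<Rightarrow> bool" where
  "minimal_hypersurface S \<longleftrightarrow>
     embedded_hypersurface C2_on S \<and> (\<forall>p\<in>S. mean_curvature_vector S p = 0)"

definition nonflat :: "(real^'n) set \<Rightarrow> bool" where
  "nonflat S \<longleftrightarrow>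
     (\<exists>p\<in>S. \<exists>u\<in>tangent_space S p. \<exists>v\<in>tangent_space S p. second_fundamental_form S p u v \<noteq> 0)"

definition weighted_dilation :: "('n \<Rightarrow> real) \<Rightarrow> real \<Rightarrow> real^'n^'n" where
  "weighted_dilation g t = (\<chi> i j. if i = j then t powr g i else 0)"

end

(*
  If g_a = g_b and c is a third index, take the helicoid x_b cos x_c = x_a sin x_c, times R^(n-3).
  D_t scales x_a and x_b by a common factor, so it only changes the pitch: the image is
  x_b cos (k x_c) = x_a sin (k x_c) with k = t^(-g_c), again a helicoid.

  On the zero set of f with gradient G and Hessian L, differentiating G . V = 0 along a curve in
  the set gives II(u,v) = - (v . L u / |G|^2) G, so minimality means trace L = G . L G / |G|^2;
  for the helicoid both sides vanish on the surface.
*)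

theory Submission
  imports Defs
begin

section \<open>Power series expansions of the defining function\<close>

lemma real_analytic_on_add:
  assumes "real_analytic_on f U" "real_analytic_on h U"
  shows "real_analytic_on (\<lambda>x. f x + h x) U"
  unfolding real_analytic_on_def
proof
  fix p assume "p \<in> U"
  obtain r c where r: "r > 0" and c: "\<And>x. x \<in> ball p r \<Longrightarrow>
      ((\<lambda>\<alpha>. c \<alpha> * (\<Prod>i\<in>UNIV. (x $ i - p $ i) ^ \<alpha> i)) has_sum f x) UNIV"
    using assms(1) \<open>p \<in> U\<close> unfolding real_analytic_on_def by blast
  obtain s d where s: "s > 0" and d: "\<And>x. x \<in> ball p s \<Longrightarrow>
      ((\<lambda>\<alpha>. d \<alpha> * (\<Prod>i\<in>UNIV. (x $ i - p $ i) ^ \<alpha> i)) has_sum h x) UNIV"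
    using assms(2) \<open>p \<in> U\<close> unfolding real_analytic_on_def by blast
  show "\<exists>r>0. \<exists>c :: ('a \<Rightarrow> nat) \<Rightarrow> real. \<forall>x\<in>ball p r.
      ((\<lambda>\<alpha>. c \<alpha> * (\<Prod>i\<in>UNIV. (x $ i - p $ i) ^ \<alpha> i)) has_sum f x + h x) UNIV"
  proof (intro exI[of _ "min r s"] exI[of _ "\<lambda>\<alpha>. c \<alpha> + d \<alpha>"] conjI ballI)
    show "min r s > 0" using r s by simp
    fix x assume "x \<in> ball p (min r s)"
    then have "x \<in> ball p r" "x \<in> ball p s" by auto
    from has_sum_add[OF c[OF this(1)] d[OF this(2)]]
    show "((\<lambda>\<alpha>. (c \<alpha> + d \<alpha>) * (\<Prod>i\<in>UNIV. (x $ i - p $ i) ^ \<alpha> i)) has_sum f x + h x) UNIV"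
      by (simp add: distrib_right)
  qed
qed

text \<open>Turns a one-variable series, times a fixed monomial in the remaining variables, into a
  series over all multi-indices. The map \<open>m \<mapsto> \<beta>(c := m)\<close> is injective, so
  the series can be reindexed along the line it traces and extended by zero off that line.\<close>

lemma has_sum_multiindex_line:
  fixes A :: "nat \<Rightarrow> real" and y :: "'n::finite \<Rightarrow> real"
  assumes "((\<lambda>m. A m * y c ^ m) has_sum s) UNIV"
  shows "((\<lambda>\<alpha>. (if \<alpha> \<in> range (\<lambda>m. \<beta>(c := m)) then A (\<alpha> c) else 0) * (\<Prod>i\<in>UNIV. y i ^ \<alpha> i))
           has_sum (\<Prod>i\<in>UNIV - {c}. y i ^ \<beta> i) * s) UNIV"
proof -
  let ?e = "\<lambda>m. \<beta>(c := m)"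
  have inj: "inj ?e" by (rule injI) (metis fun_upd_same)
  have pr: "(\<Prod>i\<in>UNIV. y i ^ ?e m i) = y c ^ m * (\<Prod>i\<in>UNIV - {c}. y i ^ \<beta> i)" for m
    by (subst prod.remove[of _ c]) auto
  have "((\<lambda>m. (\<Prod>i\<in>UNIV - {c}. y i ^ \<beta> i) * (A m * y c ^ m)) has_sum (\<Prod>i\<in>UNIV - {c}. y i ^ \<beta> i) * s) UNIV"
    using assms by (rule has_sum_cmult_right)
  then have "(((\<lambda>\<alpha>. A (\<alpha> c) * (\<Prod>i\<in>UNIV. y i ^ \<alpha> i)) \<circ> ?e)
      has_sum (\<Prod>i\<in>UNIV - {c}. y i ^ \<beta> i) * s) UNIV"
    by (simp add: o_def pr mult_ac del: fun_upd_apply) (simp add: mult_ac)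
  then have "((\<lambda>\<alpha>. A (\<alpha> c) * (\<Prod>i\<in>UNIV. y i ^ \<alpha> i))
      has_sum (\<Prod>i\<in>UNIV - {c}. y i ^ \<beta> i) * s) (range ?e)"
    by (subst has_sum_reindex[OF inj])
  then show ?thesis
    by (rule has_sum_cong_neutral[THEN iffD1, rotated -1]) auto
qed

lemma has_sum_cos_sin:
  fixes P Q y :: real
  shows "((\<lambda>m. (P * cos_coeff m + Q * sin_coeff m) * y ^ m) has_sum (P * cos y + Q * sin y)) UNIV"
proof -
  have "((\<lambda>m. cos_coeff m * y ^ m) has_sum cos y) UNIV"
    using norm_summable_imp_has_sum[OF summable_norm_cos cos_converges, of y] by simp
  moreover have "((\<lambda>m. sin_coeff m * y ^ m) has_sum sin y) UNIV"
    using norm_summable_imp_has_sum[OF summable_norm_sin sin_converges, of y] by simp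
  ultimately have "((\<lambda>m. P * (cos_coeff m * y ^ m) + Q * (sin_coeff m * y ^ m)) has_sum
      P * cos y + Q * sin y) UNIV"
    by (intro has_sum_add has_sum_cmult_right)
  then show ?thesis by (simp add: algebra_simps)
qed

text \<open>The constant and the linear part of \<open>x $ d\<close> at the base point each contribute a
  series along one line of multi-indices.\<close>

lemma real_analytic_on_coord_mult_cos_sin:
  fixes c d :: "'n::finite"
  assumes "d \<noteq> c"
  shows "real_analytic_on (\<lambda>x. x $ d * (P * cos (x $ c) + Q * sin (x $ c))) U"
  unfolding real_analytic_on_def
proof
  fix p :: "real^'n"
  \<comment> \<open>Recentring at \<open>p\<close>: by the addition theorems these are the
    coefficients of \<open>P * cos + Q * sin\<close> in terms of the increment
    \<open>x $ c - p $ c\<close>.\<close>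
  define P' Q' where "P' = P * cos (p $ c) + Q * sin (p $ c)" and "Q' = Q * cos (p $ c) - P * sin (p $ c)"
  define A where "A = (\<lambda>m. P' * cos_coeff m + Q' * sin_coeff m :: real)"
  define C where "C = (\<lambda>(\<beta> :: 'n \<Rightarrow> nat) \<alpha>. if \<alpha> \<in> range (\<lambda>m. \<beta>(c := m)) then A (\<alpha> c) else 0)"
  define \<delta> :: "'n \<Rightarrow> nat" where "\<delta> = (\<lambda>i. if i = d then 1 else 0)"
  have "((\<lambda>\<alpha>. (p $ d * C (\<lambda>_. 0) \<alpha> + C \<delta> \<alpha>) * (\<Prod>i\<in>UNIV. (x $ i - p $ i) ^ \<alpha> i)) has_sum
      x $ d * (P * cos (x $ c) + Q * sin (x $ c))) UNIV" for x
  proof -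
    define y where "y = (\<lambda>i. x $ i - p $ i)"
    define s where "s = P' * cos (y c) + Q' * sin (y c)"
    have s: "s = P * cos (x $ c) + Q * sin (x $ c)"
    proof -
      have "x $ c = p $ c + y c" by (simp add: y_def)
      then show ?thesis by (simp add: s_def P'_def Q'_def cos_add sin_add algebra_simps)
    qed
    have *: "((\<lambda>\<alpha>. C \<beta> \<alpha> * (\<Prod>i\<in>UNIV. y i ^ \<alpha> i)) has_sum (\<Prod>i\<in>UNIV - {c}. y i ^ \<beta> i) * s) UNIV" for \<beta>
      unfolding C_def s_def A_def by (intro has_sum_multiindex_line has_sum_cos_sin)
    have \<delta>: "(\<Prod>i\<in>UNIV - {c}. y i ^ \<delta> i) = y d"
      using assms by (subst prod.remove[of _ d]) (auto simp: \<delta>_def)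
    have "((\<lambda>\<alpha>. p $ d * (C (\<lambda>_. 0) \<alpha> * (\<Prod>i\<in>UNIV. y i ^ \<alpha> i)) + C \<delta> \<alpha> * (\<Prod>i\<in>UNIV. y i ^ \<alpha> i)) has_sum
       p $ d * s + y d * s) UNIV"
      using has_sum_add[OF has_sum_cmult_right[OF *[of "\<lambda>_. 0"], of "p $ d"] *[of \<delta>]] by (simp add: \<delta>)
    moreover have "p $ d * s + y d * s = x $ d * (P * cos (x $ c) + Q * sin (x $ c))"
      unfolding s by (simp add: y_def algebra_simps)
    ultimately show ?thesis by (simp add: y_def algebra_simps)
  qed
  then show "\<exists>r>0. \<exists>C :: ('n \<Rightarrow> nat) \<Rightarrow> real. \<forall>x\<in>ball p r.
      ((\<lambda>\<alpha>. C \<alpha> * (\<Prod>i\<in>UNIV. (x $ i - p $ i) ^ \<alpha> i)) has_sum x $ d * (P * cos (x $ c) + Q * sin (x $ c))) UNIV"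
    \<comment> \<open>The expansion holds for all \<open>x\<close>, so any radius would do.\<close>
    by (intro exI[of _ "1::real"] exI[of _ "\<lambda>\<alpha>. p $ d * C (\<lambda>_. 0) \<alpha> + C \<delta> \<alpha>"] conjI) auto
qed

section \<open>Curvature of level sets in terms of gradient and Hessian\<close>

text \<open>Only this inclusion follows from the chain rule. The converse needs curves in
  \<open>S\<close> with prescribed velocity; for the helicoid these are written down explicitly,
  which avoids an implicit function argument.\<close>

lemma tangent_space_level_set_subset:
  assumes "(f has_derivative (\<lambda>h. G \<bullet> h)) (at p)" "\<And>x. x \<in> S \<Longrightarrow> f x = 0" "v \<in> tangent_space S p"
  shows "G \<bullet> v = 0"
proof -
  obtain \<epsilon> \<gamma> where \<gamma>: "\<epsilon> > 0" "\<gamma> ` {-\<epsilon><..<\<epsilon>} \<subseteq> S" "\<gamma> 0 = p" "(\<gamma> has_vector_derivative v) (at 0)"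
    using assms(3) unfolding tangent_space_def by blast
  have "((f \<circ> \<gamma>) has_derivative (\<lambda>h. G \<bullet> h) \<circ> (\<lambda>h. h *\<^sub>R v)) (at 0)"
    using \<gamma>(3,4) assms(1) unfolding has_vector_derivative_def by (intro diff_chain_at) auto
  moreover have "((f \<circ> \<gamma>) has_derivative (\<lambda>h. 0)) (at 0)"
  proof (rule has_derivative_transform_within_open[where f = "\<lambda>_. 0" and s = "{-\<epsilon><..<\<epsilon>}"])
    show "0 = (f \<circ> \<gamma>) s" if "s \<in> {-\<epsilon><..<\<epsilon>}" for s
      using assms(2)[of "\<gamma> s"] \<gamma>(2) that by (auto simp: image_subset_iff)
  qed (use \<gamma> in auto)
  ultimately have "(\<lambda>h. G \<bullet> h) \<circ> (\<lambda>h. h *\<^sub>R v) = (\<lambda>h. 0)"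
    by (rule has_derivative_unique)
  from fun_cong[OF this, of 1] show ?thesis by simp
qed

text \<open>The right-hand side does not mention \<open>V\<close>: the normal component is the same
  for all tangent extensions, which is what makes the definite description in
  \<open>second_fundamental_form\<close> well defined.\<close>

lemma normal_component_tangent_extension:
  assumes T: "\<And>q. q \<in> S \<Longrightarrow> tangent_space S q = {v. G q \<bullet> v = 0}"
    and G: "(G has_derivative L) (at p)"
    and u: "u \<in> tangent_space S p"
    and V: "tangent_extension S p v V"
  shows "G p \<bullet> frechet_derivative V (at p) u = - (v \<bullet> L u)"
proof -
  obtain \<epsilon> \<gamma> where \<gamma>: "\<epsilon> > 0" "\<gamma> ` {-\<epsilon><..<\<epsilon>} \<subseteq> S" "\<gamma> 0 = p" "(\<gamma> has_vector_derivative u) (at 0)"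
    using u unfolding tangent_space_def by blast
  obtain U where U: "open U" "p \<in> U" "V differentiable_on U" "V p = v"
      "\<And>q. q \<in> S \<inter> U \<Longrightarrow> V q \<in> tangent_space S q"
    using V unfolding tangent_extension_def by blast
  let ?D = "frechet_derivative V (at p)"
  have D: "(V has_derivative ?D) (at p)"
    using U(1-3) by (metis differentiable_on_eq_differentiable_at frechet_derivative_works)
  have d\<gamma>: "(\<gamma> has_derivative (\<lambda>h. h *\<^sub>R u)) (at 0)"
    using \<gamma>(4) by (simp add: has_vector_derivative_def)
  have 1: "((\<lambda>s. V (\<gamma> s)) has_derivative (\<lambda>h. ?D (h *\<^sub>R u))) (at 0)"
    using diff_chain_at[OF d\<gamma>, of V ?D] D \<gamma>(3) by (simp add: o_def)
  have 2: "((\<lambda>s. G (\<gamma> s)) has_derivative (\<lambda>h. L (h *\<^sub>R u))) (at 0)"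
    using diff_chain_at[OF d\<gamma>, of G L] G \<gamma>(3) by (simp add: o_def)
  have "((\<lambda>s. G (\<gamma> s) \<bullet> V (\<gamma> s)) has_derivative (\<lambda>h. G (\<gamma> 0) \<bullet> ?D (h *\<^sub>R u) + L (h *\<^sub>R u) \<bullet> V (\<gamma> 0))) (at 0)"
    using has_derivative_inner[OF 2 1] .
  moreover have "((\<lambda>s. G (\<gamma> s) \<bullet> V (\<gamma> s)) has_derivative (\<lambda>h. 0)) (at 0)"
  proof -
    \<comment> \<open>\<open>V\<close> is known to be tangent only on \<open>S \<inter> U\<close>,
      so the curve is restricted to times at which it stays in \<open>U\<close>.\<close>
    have "isCont \<gamma> 0" using d\<gamma> by (rule has_derivative_continuous)
    moreover have "\<gamma> 0 \<in> U" using U(2) \<gamma>(3) by simp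
    ultimately have "\<exists>W. open W \<and> 0 \<in> W \<and> (\<forall>s\<in>W. \<gamma> s \<in> U)"
      using U(1) unfolding continuous_at_open by (elim allE[of _ U] impE) simp_all
    then obtain W where W: "open W" "0 \<in> W" "\<And>s. s \<in> W \<Longrightarrow> \<gamma> s \<in> U"
      by blast
    show ?thesis
    proof (rule has_derivative_transform_within_open[where f = "\<lambda>_. 0"])
      show "open (W \<inter> {-\<epsilon><..<\<epsilon>})" using W(1) by (intro open_Int) simp_all
      show "0 \<in> W \<inter> {-\<epsilon><..<\<epsilon>}" using W(2) \<gamma>(1) by simp
      fix s assume s: "s \<in> W \<inter> {-\<epsilon><..<\<epsilon>}"
      have "\<gamma> s \<in> S \<inter> U" using \<gamma>(2) W(3) s by auto
      then show "0 = G (\<gamma> s) \<bullet> V (\<gamma> s)" using U(5)[of "\<gamma> s"] T[of "\<gamma> s"] by simp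
    qed (rule has_derivative_const)
  qed
  ultimately have "(\<lambda>h. G (\<gamma> 0) \<bullet> ?D (h *\<^sub>R u) + L (h *\<^sub>R u) \<bullet> V (\<gamma> 0)) = (\<lambda>h. 0)"
    by (rule has_derivative_unique)
  from fun_cong[OF this, of 1] show ?thesis
    using \<gamma>(3) U(4) by (simp add: inner_commute)
qed

text \<open>The part \<open>z\<close> of \<open>w\<close> orthogonal to \<open>n\<close> is, by
  hypothesis, also orthogonal to \<open>w\<close>; hence \<open>z\<close> is orthogonal to
  itself.\<close>

lemma orthogonal_complement_hyperplane:
  fixes n w :: "'a::real_inner"
  assumes "n \<noteq> 0" "\<And>z. n \<bullet> z = 0 \<Longrightarrow> w \<bullet> z = 0"
  shows "w = ((n \<bullet> w) / (n \<bullet> n)) *\<^sub>R n"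
proof -
  define z where "z = w - ((n \<bullet> w) / (n \<bullet> n)) *\<^sub>R n"
  have "n \<bullet> z = 0" using assms(1) by (simp add: z_def inner_diff_right)
  then have "z \<bullet> z = 0"
    using assms(2)[of z] by (subst (1) z_def) (simp add: inner_diff_left)
  then show ?thesis by (simp add: z_def)
qed

lemma second_fundamental_form_level_set:
  assumes T: "\<And>q. q \<in> S \<Longrightarrow> tangent_space S q = {v. G q \<bullet> v = 0}"
    and nz: "\<And>q. G q \<noteq> 0"
    and diff: "\<And>q. G differentiable (at q)"
    and G: "(G has_derivative L) (at p)"
    and p: "p \<in> S" and u: "G p \<bullet> u = 0" and v: "G p \<bullet> v = 0"
  shows "second_fundamental_form S p u v = (- (v \<bullet> L u) / (G p \<bullet> G p)) *\<^sub>R G p"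
    (is "_ = ?w")
  unfolding second_fundamental_form_def
proof (rule the_equality)
  \<comment> \<open>The constant field \<open>v\<close> projected at each \<open>q\<close> onto the
    hyperplane orthogonal to \<open>G q\<close>. Since \<open>G\<close> vanishes nowhere, this is
    differentiable on the whole space, and at \<open>p\<close> it returns \<open>v\<close> because
    \<open>v\<close> is tangent there.\<close>
  define V where "V = (\<lambda>q. v - ((G q \<bullet> v) / (G q \<bullet> G q)) *\<^sub>R G q)"
  have "V differentiable (at q)" for q
    unfolding V_def using diff[of q] nz[of q]
    by (intro differentiable_diff differentiable_const differentiable_scaleR
        differentiable_divide differentiable_inner) auto
  then have "V differentiable_on UNIV"
    by (simp add: differentiable_on_def)
  moreover have "V q \<in> tangent_space S q" if "q \<in> S" for q
    unfolding T[OF that] V_def using nz[of q] by (simp add: inner_diff_right)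
  moreover have "V p = v" by (simp add: V_def v)
  ultimately have V: "tangent_extension S p v V"
    unfolding tangent_extension_def by (intro conjI exI[of _ UNIV]) simp_all
  have "G p \<bullet> frechet_derivative V (at p) u = - (v \<bullet> L u)"
    by (rule normal_component_tangent_extension[OF T G _ V]) (simp_all add: T[OF p] u)
  then have "frechet_derivative V (at p) u - ?w \<in> tangent_space S p"
    unfolding T[OF p] using nz[of p] by (simp add: inner_diff_right inner_add_right)
  moreover have "\<forall>z\<in>tangent_space S p. ?w \<bullet> z = 0"
    unfolding T[OF p] by simp
  ultimately show "\<exists>V. tangent_extension S p v V \<and> frechet_derivative V (at p) u - ?w \<in> tangent_space S p \<and>
      (\<forall>z\<in>tangent_space S p. ?w \<bullet> z = 0)"
    using V by (intro exI[of _ V] conjI)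
next
  fix w
  assume "\<exists>V. tangent_extension S p v V \<and> frechet_derivative V (at p) u - w \<in> tangent_space S p \<and>
      (\<forall>z\<in>tangent_space S p. w \<bullet> z = 0)"
  then obtain V where V: "tangent_extension S p v V" "G p \<bullet> (frechet_derivative V (at p) u - w) = 0"
      and w: "\<And>z. G p \<bullet> z = 0 \<Longrightarrow> w \<bullet> z = 0"
    unfolding T[OF p] by blast
  have "G p \<bullet> frechet_derivative V (at p) u = - (v \<bullet> L u)"
    by (rule normal_component_tangent_extension[OF T G _ V(1)]) (simp_all add: T[OF p] u)
  then have "G p \<bullet> w = - (v \<bullet> L u)"
    using V(2) by (simp add: inner_diff_right)
  then show "w = ?w"
    using orthogonal_complement_hyperplane[OF nz[of p] w] by simp
qed

text \<open>Expanding the first \<open>e\<close> in \<open>e \<bullet> L e\<close> along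
  \<open>Basis\<close> and swapping the sums leaves inner sums over \<open>B\<close>, which
  Parseval's identity for \<open>B\<close> evaluates.\<close>

lemma orthonormal_basis_trace:
  fixes L :: "'a::euclidean_space \<Rightarrow> 'a"
  assumes "linear L" "pairwise orthogonal B" "\<And>e. e \<in> B \<Longrightarrow> norm e = 1" "span B = UNIV"
  shows "(\<Sum>e\<in>B. e \<bullet> L e) = (\<Sum>i\<in>Basis. i \<bullet> L i)"
proof -
  have fin: "finite B"
    using assms(2) by (rule pairwise_orthogonal_imp_finite)
  have parseval: "(\<Sum>e\<in>B. (e \<bullet> x) * (e \<bullet> y)) = x \<bullet> y" for x y
  proof -
    have "x \<bullet> y = (\<Sum>e\<in>B. (e \<bullet> x) *\<^sub>R e) \<bullet> y"
      using orthonormal_basis_expand[OF assms(2,3), of x] assms(4) fin by (simp add: inner_commute)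
    then show ?thesis by (simp add: inner_sum_left)
  qed
  have "e \<bullet> L e = (\<Sum>i\<in>Basis. (e \<bullet> i) * (e \<bullet> L i))" for e
  proof -
    have "L e = (\<Sum>i\<in>Basis. (e \<bullet> i) *\<^sub>R L i)"
      by (subst (1) euclidean_representation[symmetric])
        (simp add: linear_sum[OF assms(1)] linear_cmul[OF assms(1)])
    then show ?thesis by (simp add: inner_sum_right)
  qed
  then have "(\<Sum>e\<in>B. e \<bullet> L e) = (\<Sum>i\<in>Basis. \<Sum>e\<in>B. (e \<bullet> i) * (e \<bullet> L i))"
    by (simp add: sum.swap[of _ B])
  then show ?thesis by (simp add: parseval)
qed

text \<open>Adjoining the unit normal to \<open>B\<close> gives an orthonormal basis of the whole
  space; the subtracted quotient is the normal's contribution to the full trace.\<close>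

lemma hyperplane_trace:
  fixes L :: "real^'n \<Rightarrow> real^'n"
  assumes L: "linear L" and B: "orthonormal_basis_of {v. n \<bullet> v = 0} B" and n: "n \<noteq> 0"
  shows "(\<Sum>e\<in>B. e \<bullet> L e) = (\<Sum>i\<in>Basis. i \<bullet> L i) - (n \<bullet> L n) / (n \<bullet> n)"
proof -
  have B': "pairwise orthogonal B" "\<And>e. e \<in> B \<Longrightarrow> norm e = 1" "span B = {v. n \<bullet> v = 0}"
    using B unfolding orthonormal_basis_of_def by auto
  have fin: "finite B" using B'(1) by (rule pairwise_orthogonal_imp_finite)
  define \<nu> where "\<nu> = (1 / norm n) *\<^sub>R n"
  have \<nu>1: "norm \<nu> = 1" using n by (simp add: \<nu>_def)
  have orth: "\<nu> \<bullet> e = 0" if "e \<in> B" for e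
    using span_base[OF that] B'(3) by (simp add: \<nu>_def)
  then have "\<nu> \<notin> B" using \<nu>1 by (metis norm_eq_1 zero_neq_one)
  have "x \<in> span (insert \<nu> B)" for x
  proof -
    have "x - (x \<bullet> \<nu>) *\<^sub>R \<nu> \<in> span B"
      using n unfolding B'(3)
      by (simp add: \<nu>_def inner_diff_right inner_commute dot_square_norm power2_eq_square)
    then show ?thesis by (metis span_breakdown_eq)
  qed
  then have "(\<Sum>e\<in>insert \<nu> B. e \<bullet> L e) = (\<Sum>i\<in>Basis. i \<bullet> L i)"
    using B'(1,2) \<nu>1 orth
    by (intro orthonormal_basis_trace[OF L])
      (auto simp: pairwise_insert orthogonal_def inner_commute)
  moreover have "\<nu> \<bullet> L \<nu> = (n \<bullet> L n) / (n \<bullet> n)"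
    by (simp add: \<nu>_def linear_cmul[OF L] dot_square_norm power2_eq_square)
  ultimately show ?thesis
    using sum.insert[OF fin \<open>\<nu> \<notin> B\<close>, of "\<lambda>e. e \<bullet> L e"] by linarith
qed

lemma mean_curvature_vector_level_set:
  assumes T: "\<And>q. q \<in> S \<Longrightarrow> tangent_space S q = {v. G q \<bullet> v = 0}"
    and nz: "\<And>q. G q \<noteq> 0"
    and diff: "\<And>q. G differentiable (at q)"
    and G: "(G has_derivative L) (at p)"
    and p: "p \<in> S"
  shows "mean_curvature_vector S p =
    (- ((\<Sum>i\<in>Basis. i \<bullet> L i) - (G p \<bullet> L (G p)) / (G p \<bullet> G p)) / (G p \<bullet> G p)) *\<^sub>R G p" (is "_ = ?h")
proof -
  have lin: "linear L" using G by (rule has_derivative_linear)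
  \<comment> \<open>The value is independent of the orthonormal basis, so uniqueness in the definite
    description is immediate once some basis exists.\<close>
  have *: "(\<Sum>e\<in>B. second_fundamental_form S p e e) = ?h"
    if B: "orthonormal_basis_of (tangent_space S p) B" for B
  proof -
    have "G p \<bullet> e = 0" if "e \<in> B" for e
      using B span_base[OF that] T[OF p] unfolding orthonormal_basis_of_def by auto
    then have "(\<Sum>e\<in>B. second_fundamental_form S p e e) =
        (\<Sum>e\<in>B. (- (e \<bullet> L e) / (G p \<bullet> G p)) *\<^sub>R G p)"
      using second_fundamental_form_level_set[OF T nz diff G p] by (intro sum.cong) auto
    also have "\<dots> = (- (\<Sum>e\<in>B. e \<bullet> L e) / (G p \<bullet> G p)) *\<^sub>R G p"
      by (simp add: scaleR_sum_left[symmetric] sum_divide_distrib sum_negf)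
    also have "(\<Sum>e\<in>B. e \<bullet> L e) = (\<Sum>i\<in>Basis. i \<bullet> L i) - (G p \<bullet> L (G p)) / (G p \<bullet> G p)"
      using B T[OF p] nz[of p] by (intro hyperplane_trace lin) auto
    finally show ?thesis .
  qed
  have "subspace {v. G p \<bullet> v = 0}" by (rule subspace_hyperplane)
  then obtain B where "pairwise orthogonal B" "\<And>e. e \<in> B \<Longrightarrow> norm e = 1" "span B = {v. G p \<bullet> v = 0}"
    by (rule orthonormal_basis_subspace) blast
  then have B: "orthonormal_basis_of (tangent_space S p) B"
    unfolding orthonormal_basis_of_def T[OF p] by simp
  show ?thesis
    unfolding mean_curvature_vector_def
  proof (rule the_equality)
    show "\<exists>B. orthonormal_basis_of (tangent_space S p) B \<and> ?h = (\<Sum>e\<in>B. second_fundamental_form S p e e)"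
      using B *[OF B, symmetric] by (intro exI[of _ B] conjI)
    show "h = ?h" if "\<exists>B. orthonormal_basis_of (tangent_space S p) B \<and>
        h = (\<Sum>e\<in>B. second_fundamental_form S p e e)" for h
      using that by (elim exE conjE) (simp only: *)
  qed
qed

section \<open>Helicoids times a flat factor: derivatives, tangent spaces, minimality, nonflatness,
  connectedness\<close>

text \<open>\<open>k\<close> is the angle turned per unit of height \<open>x $ c\<close>. It stays a
  parameter because the dilations change it.\<close>

definition helicoid_fun :: "'n \<Rightarrow> 'n \<Rightarrow> 'n \<Rightarrow> real \<Rightarrow> real^'n \<Rightarrow> real" where
  "helicoid_fun a b c k x = x $ b * cos (k * x $ c) - x $ a * sin (k * x $ c)"

definition helicoid_grad :: "'n::finite \<Rightarrow> 'n \<Rightarrow> 'n \<Rightarrow> real \<Rightarrow> real^'n \<Rightarrow> real^'n" where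
  "helicoid_grad a b c k x = cos (k * x $ c) *\<^sub>R axis b 1 - sin (k * x $ c) *\<^sub>R axis a 1
     - (k * (x $ b * sin (k * x $ c) + x $ a * cos (k * x $ c))) *\<^sub>R axis c 1"

text \<open>The Hessian as a linear map. The second derivative in direction \<open>c\<close> is
  written as \<open>- k\<^sup>2\<close> times the function itself, so that it visibly vanishes on
  the surface.\<close>

definition helicoid_hess :: "'n::finite \<Rightarrow> 'n \<Rightarrow> 'n \<Rightarrow> real \<Rightarrow> real^'n \<Rightarrow> real^'n \<Rightarrow> real^'n" where
  "helicoid_hess a b c k x h =
     - ((k * sin (k * x $ c) * h $ c) *\<^sub>R axis b 1 + (k * cos (k * x $ c) * h $ c) *\<^sub>R axis a 1
       + (k * (h $ b * sin (k * x $ c) + h $ a * cos (k * x $ c)) + k\<^sup>2 * helicoid_fun a b c k x * h $ c) *\<^sub>R axis c 1)"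

definition helicoid :: "'n \<Rightarrow> 'n \<Rightarrow> 'n \<Rightarrow> real \<Rightarrow> (real^'n) set" where
  "helicoid a b c k = {x. helicoid_fun a b c k x = 0}"

lemma has_derivative_vec_nth' [derivative_intros]:
  "(f has_derivative f') F \<Longrightarrow> ((\<lambda>x. f x $ i) has_derivative (\<lambda>h. f' h $ i)) F"
  by (rule bounded_linear.has_derivative[OF bounded_linear_vec_nth])

lemma axis_nth_if: "axis i x $ j = (if j = i then x else 0)"
  by (simp add: axis_def)

lemma has_derivative_helicoid_fun:
  "(helicoid_fun a b c k has_derivative (\<lambda>h. helicoid_grad a b c k x \<bullet> h)) (at x)"
proof -
  have "(helicoid_fun a b c k has_derivative (\<lambda>h. h $ b * cos (k * x $ c) - x $ b * (k * h $ c) * sin (k * x $ c)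
      - (h $ a * sin (k * x $ c) + x $ a * (k * h $ c) * cos (k * x $ c)))) (at x)"
    unfolding helicoid_fun_def
    by (rule derivative_eq_intros refl | rule ext | simp)+
  moreover have "helicoid_grad a b c k x \<bullet> h = h $ b * cos (k * x $ c) - x $ b * (k * h $ c) * sin (k * x $ c)
      - (h $ a * sin (k * x $ c) + x $ a * (k * h $ c) * cos (k * x $ c))" for h
    by (simp add: helicoid_grad_def inner_diff_left inner_axis' algebra_simps)
  ultimately show ?thesis by simp
qed

lemma has_derivative_helicoid_grad:
  "(helicoid_grad a b c k has_derivative helicoid_hess a b c k x) (at x)"
proof -
  let ?C = "cos (k * x $ c)" and ?S = "sin (k * x $ c)"
  have "(helicoid_grad a b c k has_derivative (\<lambda>h. (- (k * h $ c) * ?S) *\<^sub>R axis b 1 - (k * h $ c * ?C) *\<^sub>R axis a 1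
      - (k * (h $ b * ?S + x $ b * (k * h $ c * ?C) + (h $ a * ?C - x $ a * (k * h $ c * ?S)))) *\<^sub>R axis c 1)) (at x)"
    unfolding helicoid_grad_def
    by (rule derivative_eq_intros refl | rule ext | simp add: algebra_simps)+
  also have "(\<lambda>h. (- (k * h $ c) * ?S) *\<^sub>R axis b 1 - (k * h $ c * ?C) *\<^sub>R axis a 1
      - (k * (h $ b * ?S + x $ b * (k * h $ c * ?C) + (h $ a * ?C - x $ a * (k * h $ c * ?S)))) *\<^sub>R axis c 1)
      = helicoid_hess a b c k x"
    by (simp add: fun_eq_iff vec_eq_iff helicoid_hess_def helicoid_fun_def power2_eq_square algebra_simps)
  finally show ?thesis .
qed

lemma helicoid_grad_nonzero:
  assumes "a \<noteq> b" "a \<noteq> c" "b \<noteq> c"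
  shows "helicoid_grad a b c k x \<noteq> 0"
proof
  assume "helicoid_grad a b c k x = 0"
  then have "helicoid_grad a b c k x $ a = 0" "helicoid_grad a b c k x $ b = 0" by simp_all
  then have "sin (k * x $ c) = 0" "cos (k * x $ c) = 0"
    using assms by (simp_all add: helicoid_grad_def axis_def)
  then show False using sin_cos_squared_add[of "k * x $ c"] by simp
qed

text \<open>The helicoid is ruled: at height \<open>x $ c\<close> the \<open>(a, b)\<close> part is
  a multiple of the unit vector with angle \<open>k * x $ c\<close>. The curve moves that multiple
  and all coordinates other than \<open>a\<close> and \<open>b\<close> linearly in time, and lets
  the \<open>(a, b)\<close> part follow the rotating ruling.\<close>

lemma helicoid_curve_with_velocity:
  assumes "a \<noteq> b" "a \<noteq> c" "b \<noteq> c"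
    and p: "p \<in> helicoid a b c k" and v: "helicoid_grad a b c k p \<bullet> v = 0"
  obtains \<gamma> where "range \<gamma> \<subseteq> helicoid a b c k" "\<gamma> 0 = p" "(\<gamma> has_vector_derivative v) (at 0)"
proof
  define C S where "C = cos (k * p $ c)" and "S = sin (k * p $ c)"
  have CS: "C * C + S * S = 1" by (simp add: C_def S_def flip: power2_eq_square)
  \<comment> \<open>Signed position of \<open>p\<close> on its ruling, and the component of
    \<open>v\<close> along that ruling.\<close>
  define \<rho> \<sigma> where "\<rho> = p $ a * C + p $ b * S" and "\<sigma> = v $ a * C + v $ b * S"
  define A B where "A = (\<lambda>s. (\<rho> + s * \<sigma>) * cos (k * (p $ c + s * v $ c)))"
    and "B = (\<lambda>s. (\<rho> + s * \<sigma>) * sin (k * (p $ c + s * v $ c)))"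
  define \<gamma> where "\<gamma> = (\<lambda>s. p + s *\<^sub>R v + (A s - p $ a - s * v $ a) *\<^sub>R axis a 1
    + (B s - p $ b - s * v $ b) *\<^sub>R axis b 1)"
  have "p $ b * C = p $ a * S"
    using p by (simp add: helicoid_def helicoid_fun_def C_def S_def)
  \<comment> \<open>Membership in the helicoid says that the \<open>(a, b)\<close> part of
    \<open>p\<close> is parallel to \<open>(C, S)\<close>.\<close>
  then have \<rho>: "\<rho> * C = p $ a" "\<rho> * S = p $ b"
    using CS unfolding \<rho>_def by algebra+
  have "C * v $ b - S * v $ a - k * \<rho> * v $ c = 0"
    using v by (simp add: helicoid_grad_def inner_diff_left inner_axis' C_def S_def \<rho>_def algebra_simps)
  \<comment> \<open>Tangency fixes the component of \<open>v\<close> along \<open>(- S, C)\<close>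
    as \<open>\<rho> * (k * v $ c)\<close>; together with \<open>\<sigma>\<close> this recovers
    \<open>v $ a\<close> and \<open>v $ b\<close>.\<close>
  then have vab: "\<sigma> * C - \<rho> * (k * v $ c * S) = v $ a" "\<sigma> * S + \<rho> * (k * v $ c * C) = v $ b"
    using CS unfolding \<sigma>_def by algebra+
  show "range \<gamma> \<subseteq> helicoid a b c k"
    using assms(1-3) by (auto simp: helicoid_def helicoid_fun_def \<gamma>_def axis_def A_def B_def)
  show "\<gamma> 0 = p"
    using \<rho> by (simp add: \<gamma>_def A_def B_def C_def S_def)
  have A: "(A has_real_derivative v $ a) (at 0)"
    unfolding A_def by (rule derivative_eq_intros refl | simp add: vab(1)[symmetric] C_def S_def algebra_simps)+
  have B: "(B has_real_derivative v $ b) (at 0)"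
    unfolding B_def by (rule derivative_eq_intros refl | simp add: vab(2)[symmetric] C_def S_def algebra_simps)+
  \<comment> \<open>The corrections along \<open>axis a 1\<close> and \<open>axis b 1\<close> have
    zero derivative at time 0, so only the velocity \<open>v\<close> of the straight line
    remains.\<close>
  have "(\<gamma> has_vector_derivative 0 + 1 *\<^sub>R v + (v $ a - 0 - 1 * v $ a) *\<^sub>R axis a 1
      + (v $ b - 0 - 1 * v $ b) *\<^sub>R axis b 1) (at 0)"
    unfolding \<gamma>_def
    by (rule derivative_eq_intros A B refl | simp)+
  then show "(\<gamma> has_vector_derivative v) (at 0)" by simp
qed

lemma tangent_space_helicoid:
  assumes "a \<noteq> b" "a \<noteq> c" "b \<noteq> c" "p \<in> helicoid a b c k"
  shows "tangent_space (helicoid a b c k) p = {v. helicoid_grad a b c k p \<bullet> v = 0}"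
proof (intro equalityI subsetI CollectI)
  fix v assume "v \<in> tangent_space (helicoid a b c k) p"
  then show "helicoid_grad a b c k p \<bullet> v = 0"
    by (rule tangent_space_level_set_subset[OF has_derivative_helicoid_fun, rotated])
      (simp add: helicoid_def)
next
  fix v assume "v \<in> {v. helicoid_grad a b c k p \<bullet> v = 0}"
  then have "helicoid_grad a b c k p \<bullet> v = 0" by simp
  then obtain \<gamma> where "range \<gamma> \<subseteq> helicoid a b c k" "\<gamma> 0 = p" "(\<gamma> has_vector_derivative v) (at 0)"
    using helicoid_curve_with_velocity[OF assms] by blast
  then show "v \<in> tangent_space (helicoid a b c k) p"
    unfolding tangent_space_def
    by (intro CollectI exI[of _ "1::real"] exI[of _ \<gamma>] conjI) auto
qed

lemma helicoid_grad_differentiable: "helicoid_grad a b c k differentiable (at x)"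
  using has_derivative_helicoid_grad unfolding differentiable_def by blast

text \<open>On the surface the Hessian has zero diagonal and only couples direction \<open>c\<close>
  with the ruling direction \<open>(cos, sin)\<close> in the \<open>(a, b)\<close> plane. The
  \<open>(a, b)\<close> part of the gradient is \<open>(- sin, cos)\<close>, orthogonal to the
  ruling, so the quadratic form of the Hessian vanishes on the gradient too.\<close>

lemma mean_curvature_vector_helicoid:
  assumes "a \<noteq> b" "a \<noteq> c" "b \<noteq> c" and p: "p \<in> helicoid a b c k"
  shows "mean_curvature_vector (helicoid a b c k) p = 0"
proof -
  let ?L = "helicoid_hess a b c k p" and ?G = "helicoid_grad a b c k p"
  have f: "helicoid_fun a b c k p = 0" using p by (simp add: helicoid_def)
  have trace: "(\<Sum>i\<in>Basis. i \<bullet> ?L i) = 0"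
  proof (rule sum.neutral, rule ballI)
    fix i :: "real^'a" assume "i \<in> Basis"
    then obtain j where "i = axis j 1" by (auto simp: Basis_vec_def)
    then show "i \<bullet> ?L i = 0"
      using assms(1-3) by (auto simp: inner_axis' helicoid_hess_def f axis_nth_if)
  qed
  have "?G \<bullet> ?L h = - (k * sin (k * p $ c) * h $ c * ?G $ b + k * cos (k * p $ c) * h $ c * ?G $ a
      + k * (h $ b * sin (k * p $ c) + h $ a * cos (k * p $ c)) * ?G $ c)" for h
    by (simp add: helicoid_hess_def f inner_add_right inner_diff_right inner_axis mult_ac)
  moreover have "?G $ a = - sin (k * p $ c)" "?G $ b = cos (k * p $ c)"
    using assms(1-3) by (simp_all add: helicoid_grad_def axis_def)
  ultimately have "?G \<bullet> ?L ?G = 0"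
    by (simp only:) (simp add: algebra_simps)
  then show ?thesis
    by (subst mean_curvature_vector_level_set[OF tangent_space_helicoid[OF assms(1-3)]
          helicoid_grad_nonzero[OF assms(1-3)] helicoid_grad_differentiable has_derivative_helicoid_grad p])
      (simp_all add: trace)
qed

lemma C2_on_helicoid_fun: "C2_on (helicoid_fun a b c k) U"
proof -
  have "linear (helicoid_hess a b c k x)" for x
    using has_derivative_helicoid_grad by (rule has_derivative_linear)
  then have "helicoid_hess a b c k x = (\<lambda>h. matrix (helicoid_hess a b c k x) *v h)" for x
    by (rule matrix_vector_mul(2)[symmetric])
  then have "(helicoid_grad a b c k has_derivative (\<lambda>h. matrix (helicoid_hess a b c k x) *v h)) (at x)" for x
    using has_derivative_helicoid_grad[of a b c k x] by metis
  moreover have "continuous_on U (\<lambda>x. matrix (helicoid_hess a b c k x))"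
    unfolding matrix_def helicoid_hess_def helicoid_fun_def by (intro continuous_intros)
  ultimately show ?thesis
    unfolding C2_on_def
    by (intro exI[of _ "helicoid_grad a b c k"] exI[of _ "\<lambda>x. matrix (helicoid_hess a b c k x)"]
        conjI ballI has_derivative_helicoid_fun)
qed

text \<open>One global defining function serves at every point. Keeping \<open>P\<close> arbitrary
  covers both the \<open>C2_on\<close> and the real-analytic case.\<close>

lemma embedded_hypersurface_helicoid:
  assumes "a \<noteq> b" "a \<noteq> c" "b \<noteq> c" "P (helicoid_fun a b c k) UNIV"
  shows "embedded_hypersurface P (helicoid a b c k)"
  unfolding embedded_hypersurface_def
proof (rule ballI, rule exI[of _ UNIV], rule exI[of _ "helicoid_fun a b c k"], intro conjI ballI)
  fix x
  show "\<exists>f'. (helicoid_fun a b c k has_derivative f') (at x) \<and> f' \<noteq> (\<lambda>h. 0)"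
  proof (intro exI conjI)
    show "(\<lambda>h. helicoid_grad a b c k x \<bullet> h) \<noteq> (\<lambda>h. 0)"
      using helicoid_grad_nonzero[OF assms(1-3)] by (metis inner_eq_zero_iff)
  qed (rule has_derivative_helicoid_fun)
qed (use assms in \<open>auto simp: helicoid_def\<close>)

lemma minimal_hypersurface_helicoid:
  assumes "a \<noteq> b" "a \<noteq> c" "b \<noteq> c"
  shows "minimal_hypersurface (helicoid a b c k)"
  unfolding minimal_hypersurface_def
  using assms embedded_hypersurface_helicoid[of a b c C2_on] C2_on_helicoid_fun mean_curvature_vector_helicoid
  by blast

text \<open>At the origin the gradient is \<open>axis b 1\<close> and the mixed Hessian entry for
  the tangent directions \<open>a\<close>, \<open>c\<close> is \<open>- k\<close>. For
  \<open>k = 0\<close> the set is the hyperplane \<open>x $ b = 0\<close>.\<close>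

lemma nonflat_helicoid:
  assumes "a \<noteq> b" "a \<noteq> c" "b \<noteq> c" "k \<noteq> 0"
  shows "nonflat (helicoid a b c k)"
proof -
  have 0: "0 \<in> helicoid a b c k" by (simp add: helicoid_def helicoid_fun_def)
  have G: "helicoid_grad a b c k 0 = axis b 1" by (simp add: helicoid_grad_def)
  have orth: "axis b 1 \<bullet> (axis a 1 :: real^'a) = 0" "axis b 1 \<bullet> (axis c 1 :: real^'a) = 0"
    using assms by (simp_all add: inner_axis_axis)
  have "second_fundamental_form (helicoid a b c k) 0 (axis a 1) (axis c 1) = k *\<^sub>R axis b 1"
    using assms orth
    by (subst second_fundamental_form_level_set[OF tangent_space_helicoid[OF assms(1-3)]
          helicoid_grad_nonzero[OF assms(1-3)] helicoid_grad_differentiable has_derivative_helicoid_grad 0])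
      (simp_all add: G inner_axis_axis inner_axis' helicoid_hess_def helicoid_fun_def axis_nth_if)
  moreover have "k *\<^sub>R axis b 1 \<noteq> (0 :: real^'a)"
    using assms(4) by (simp add: axis_eq_0_iff)
  ultimately show ?thesis
    unfolding nonflat_def using 0 orth tangent_space_helicoid[OF assms(1-3) 0]
    by (intro bexI[of _ 0] bexI[of _ "axis a 1"] bexI[of _ "axis c 1"]) (simp_all add: G)
qed

lemma connected_helicoid:
  assumes "a \<noteq> b" "a \<noteq> c" "b \<noteq> c"
  shows "connected (helicoid a b c k)"
proof -
  \<comment> \<open>The global ruled parametrization: \<open>x $ a\<close> is read as the signed
    position on the ruling, and \<open>x $ b\<close> is overwritten.\<close>
  define \<phi> :: "real^'a \<Rightarrow> real^'a" where
    "\<phi> = (\<lambda>x. x + (x $ a * cos (k * x $ c) - x $ a) *\<^sub>R axis a 1 + (x $ a * sin (k * x $ c) - x $ b) *\<^sub>R axis b 1)"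
  have "range \<phi> = helicoid a b c k"
  proof (intro equalityI subsetI)
    fix x assume "x \<in> range \<phi>"
    then show "x \<in> helicoid a b c k"
      using assms by (auto simp: \<phi>_def helicoid_def helicoid_fun_def axis_def)
  next
    fix x assume x: "x \<in> helicoid a b c k"
    define C S where "C = cos (k * x $ c)" and "S = sin (k * x $ c)"
    have CS: "C * C + S * S = 1" by (simp add: C_def S_def flip: power2_eq_square)
    define \<rho> where "\<rho> = x $ a * C + x $ b * S"
    have "x $ b * C = x $ a * S"
      using x by (simp add: helicoid_def helicoid_fun_def C_def S_def)
    then have \<rho>: "\<rho> * C = x $ a" "\<rho> * S = x $ b"
      using CS unfolding \<rho>_def by algebra+
    \<comment> \<open>A preimage is obtained by putting the ruling position \<open>\<rho>\<close> in
      place of coordinate \<open>a\<close>; its coordinate \<open>b\<close> is immaterial.\<close>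
    have "x = \<phi> (x + (\<rho> - x $ a) *\<^sub>R axis a 1)"
      using assms \<rho> by (auto simp: \<phi>_def vec_eq_iff axis_def C_def S_def)
    then show "x \<in> range \<phi>" by blast
  qed
  moreover have "continuous_on UNIV \<phi>"
    unfolding \<phi>_def by (intro continuous_intros)
  ultimately show ?thesis
    by (metis connected_UNIV connected_continuous_image)
qed

text \<open>\<open>k = 1\<close> suffices: analyticity is claimed for the initial surface only, and
  minimality of its dilates asks for \<open>C2_on\<close>.\<close>

lemma real_analytic_on_helicoid_fun:
  assumes "a \<noteq> c" "b \<noteq> c"
  shows "real_analytic_on (helicoid_fun a b c 1) U"
  using real_analytic_on_add[OF real_analytic_on_coord_mult_cos_sin[OF assms(2), of 1 0]
      real_analytic_on_coord_mult_cos_sin[OF assms(1), of 0 "-1"]]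
  by (simp add: helicoid_fun_def[abs_def])

section \<open>Weighted dilations of helicoids and the existence theorem\<close>

lemma weighted_dilation_mult_vec_nth: "(weighted_dilation g t *v x) $ i = t powr g i * x $ i"
  by (simp add: weighted_dilation_def matrix_vector_mult_def if_distrib[of "\<lambda>y. y * _"] cong: if_cong)

text \<open>Dividing \<open>k\<close> by \<open>t powr g c\<close> keeps the angle at the dilated
  point unchanged, and equal weights let the common factor \<open>t powr g a\<close> be pulled out
  of the defining function.\<close>

lemma weighted_dilation_helicoid:
  assumes "g a = g b" "t > 0"
  shows "(\<lambda>x. weighted_dilation g t *v x) ` helicoid a b c k = helicoid a b c (k / t powr g c)"
proof (intro equalityI subsetI)
  have *: "helicoid_fun a b c (k / t powr g c) (weighted_dilation g t *v x) = t powr g a * helicoid_fun a b c k x" for x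
    using assms by (simp add: helicoid_fun_def weighted_dilation_mult_vec_nth algebra_simps)
  show "y \<in> helicoid a b c (k / t powr g c)" if "y \<in> (\<lambda>x. weighted_dilation g t *v x) ` helicoid a b c k" for y
    using that * by (auto simp: helicoid_def)
  fix y assume y: "y \<in> helicoid a b c (k / t powr g c)"
  define x where "x = (\<chi> i. y $ i / t powr g i)"
  have "y = weighted_dilation g t *v x"
    using assms(2) by (simp add: vec_eq_iff weighted_dilation_mult_vec_nth x_def)
  moreover from this have "x \<in> helicoid a b c k"
    using y *[of x] assms(2) by (simp add: helicoid_def)
  ultimately show "y \<in> (\<lambda>x. weighted_dilation g t *v x) ` helicoid a b c k" by blast
qed

theorem proposition3p8:
  fixes g :: "'n::finite \<Rightarrow> real"
  assumes "CARD('n) \<ge> 3"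
    and "\<And>i. g i > 0"
    and "\<exists>a b. a \<noteq> b \<and> g a = g b"
  shows "\<exists>\<Sigma> :: (real^'n) set.
           embedded_hypersurface real_analytic_on \<Sigma> \<and> connected \<Sigma> \<and>
           minimal_hypersurface \<Sigma> \<and> nonflat \<Sigma> \<and>
           (\<forall>t>0. minimal_hypersurface ((\<lambda>x. weighted_dilation g t *v x) ` \<Sigma>))"
proof -
  obtain a b where ab: "a \<noteq> b" "g a = g b" using assms(3) by blast
  have "card {a, b} < CARD('n)" using ab(1) assms(1) by simp
  then have "{a, b} \<noteq> UNIV" by auto
  then obtain c where "c \<noteq> a" "c \<noteq> b" by blast
  then have ne: "a \<noteq> b" "a \<noteq> c" "b \<noteq> c" using ab(1) by auto
  show ?thesis
  proof (intro exI[of _ "helicoid a b c 1"] conjI allI impI)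
    show "embedded_hypersurface real_analytic_on (helicoid a b c 1)"
      using ne real_analytic_on_helicoid_fun by (intro embedded_hypersurface_helicoid) auto
    show "nonflat (helicoid a b c 1)"
      using ne by (intro nonflat_helicoid) auto
    \<comment> \<open>Helicoids are minimal for every real \<open>k\<close>, so it is enough that
      the dilate is again a helicoid.\<close>
    show "minimal_hypersurface ((\<lambda>x. weighted_dilation g t *v x) ` helicoid a b c 1)" if "t > 0" for t
      unfolding weighted_dilation_helicoid[of g a b t, OF ab(2) that] using ne by (rule minimal_hypersurface_helicoid)
  qed (use ne in \<open>auto intro: connected_helicoid minimal_hypersurface_helicoid\<close>)
qed

end
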